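(* Let $\beta>0$, let $\boldsymbol{V}=(V_t)_{t\in[0,1]}$ be a standard generalized Pareto process corresponding to the parameter $\beta$ and the density $\psi$ (see context), and let $\boldsymbol{V}^{(1)},\boldsymbol{V}^{(2)},\dots$ be independent copies of $\boldsymbol{V}$. For $c<0$ put $$\widehat\Psi_{c,n}:=\frac{1}{2|c|n}\sum_{i=1}^n 1\left(V^{(i)}_t>c \text{ for all } t\in[0,1]\right),\qquad \widehat\beta_{c,n}:=-2\Psi^{-1}\left(\widehat\Psi_{c,n}\right).$$ Then for $c<0$ close enough to $0$ we have, as $n\to\infty$, $$n^{1/2}\left(\widehat\Psi_{c,n}-\Psi\left(-\tfrac{\beta}{2}\right)\right)\to_D N\left(0,\frac{\Psi\left(-\frac{\beta}{2}\right)\left(1-2|c|\Psi\left(-\frac{\beta}{2}\right)\right)}{2|c|}\right)$$ and $$n^{1/2}\left(\widehat\beta_{c,n}-\beta\right)\to_D N\left(0,\frac{2\Psi\left(-\frac{\beta}{2}\right)\left(1-2|c|\Psi\left(-\frac{\beta}{2}\right)\right)}{|c|\,\psi^2\left(-\frac{\beta}{2}\right)}\right).$$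
   Context: $\psi$ is a known continuous probability density on $\mathbb{R}$ with $\psi(s)=\psi(-s)>0$ for all $s$ and $\psi(s)$, $s\ge 0$, decreasing; $\Psi(x)=\int_{-\infty}^x\psi(s)\,ds$, and $\Psi^{-1}(q)=\inf\{t\in\mathbb{R}:\Psi(t)\ge q\}$ for $q\in(0,1)$. The value assigned to $\widehat\beta_{c,n}$ when $\widehat\Psi_{c,n}\notin(0,1)$ is immaterial. $\psi_\beta(s):=\beta\psi(\beta s)$. $\bar E^-[0,1]$ is the set of bounded functions $f:[0,1]\to(-\infty,0]$ with a finite set of discontinuities; $\|f\|_\infty=\sup_{t\in[0,1]}|f(t)|$. Inequalities between functions are pointwise for all $t\in[0,1]$. A standard extreme value process (EVP) is a process $\boldsymbol{\eta}=(\eta_t)_{t\in[0,1]}$ with sample paths in $C[0,1]$, with $P(\eta_t\le x)=e^x$ for $x\le 0$, $t\in[0,1]$, and $P(\boldsymbol{\eta}\le f/n)^n=P(\boldsymbol{\eta}\le f)$ for all $f\in\bar E^-[0,1]$, $n\in\mathbb{N}$. The EVP with parameter $\beta$ has the finite dimensional distributions $$P(\eta_{t_j}\le x_j,\,1\le j\le d)=\exp\left(-\int_{-\infty}^\infty\max_{j\le d}\left(|x_j|\psi_\beta(s-t_j)\right)ds\right),\quad x_j\le 0,\ t_j\in[0,1],\ d\in\mathbb{N}.$$ A standard generalized Pareto process (GPP) corresponding to $\beta$ and $\psi$ is a process $\boldsymbol{V}$ with sample paths in $C[0,1]$ for which there is $x_0>0$ with $P(\boldsymbol{V}\le f)=1+\log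 P(\boldsymbol{\eta}\le f)$ for all $f\in\bar E^-[0,1]$ with $\|f\|_\infty\le x_0$, where $\boldsymbol{\eta}$ is this EVP. $\to_D$ denotes convergence in distribution, $N(a,b)$ the normal distribution with mean $a$ and variance $b$. *)

theory Defs
  imports "HOL-Probability.Probability"
begin

definition unimodal_density :: "(real \<Rightarrow> real) \<Rightarrow> bool" where
  "unimodal_density \<psi> \<longleftrightarrow>
     continuous_on UNIV \<psi> \<and> integrable lborel \<psi> \<and> (LBINT s. \<psi> s) = 1 \<and>
     (\<forall>s. \<psi> s > 0) \<and> (\<forall>s. \<psi> (- s) = \<psi> s) \<and> antimono_on {0..} \<psi>"

definition df :: "(real \<Rightarrow> real) \<Rightarrow> real \<Rightarrow> real" where
  "df \<psi> x = (LBINT s:{..x}. \<psi> s)"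

text \<open>Only meaningful for \<open>q\<close> in \<open>(0,1)\<close>.\<close>

definition quantile :: "(real \<Rightarrow> real) \<Rightarrow> real \<Rightarrow> real" where
  "quantile \<psi> q = Inf {t. df \<psi> t \<ge> q}"

definition scaled :: "(real \<Rightarrow> real) \<Rightarrow> real \<Rightarrow> real \<Rightarrow> real" where
  "scaled \<psi> \<beta> s = \<beta> * \<psi> (\<beta> * s)"

text \<open>Functions on \<open>[0,1]\<close> are represented by functions on the reals whose values outside
  \<open>[0,1]\<close> are irrelevant; continuity is relative to \<open>[0,1]\<close>.\<close>

definition E_minus :: "(real \<Rightarrow> real) set" where
  "E_minus = {f. (\<forall>t\<in>{0..1}. f t \<le> 0) \<and> bounded (f ` {0..1}) \<and>
                 finite {t\<in>{0..1}. \<not> continuous (at t within {0..1}) f}}"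

definition sup_norm :: "(real \<Rightarrow> real) \<Rightarrow> real" where
  "sup_norm f = (SUP t\<in>{0..1}. \<bar>f t\<bar>)"

definition continuous_process :: "'a measure \<Rightarrow> (real \<Rightarrow> 'a \<Rightarrow> real) \<Rightarrow> bool" where
  "continuous_process M X \<longleftrightarrow>
     (\<forall>t\<in>{0..1}. X t \<in> borel_measurable M) \<and>
     (\<forall>\<omega>\<in>space M. continuous_on {0..1} (\<lambda>t. X t \<omega>))"

text \<open>The distribution function of a process, \<open>P(X \<le> f)\<close>. For a continuous process and
  \<open>f\<close> in \<^const>\<open>E_minus\<close> the event is determined by countably many points, hence measurable.\<close>

definition process_df :: "'a measure \<Rightarrow> (real \<Rightarrow> 'a \<Rightarrow> real) \<Rightarrow> (real \<Rightarrow> real) \<Rightarrow> real" where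
  "process_df M X f = measure M {\<omega>\<in>space M. \<forall>t\<in>{0..1}. X t \<omega> \<le> f t}"

definition standard_EVP :: "'a measure \<Rightarrow> (real \<Rightarrow> 'a \<Rightarrow> real) \<Rightarrow> bool" where
  "standard_EVP M \<eta> \<longleftrightarrow>
     prob_space M \<and> continuous_process M \<eta> \<and>
     (\<forall>t\<in>{0..1}. \<forall>x\<le>0. measure M {\<omega>\<in>space M. \<eta> t \<omega> \<le> x} = exp x) \<and>
     (\<forall>f\<in>E_minus. \<forall>n\<ge>1. process_df M \<eta> (\<lambda>t. f t / real n) ^ n = process_df M \<eta> f)"

definition EVP_with_parameter ::
    "(real \<Rightarrow> real) \<Rightarrow> real \<Rightarrow> 'a measure \<Rightarrow> (real \<Rightarrow> 'a \<Rightarrow> real) \<Rightarrow> bool" where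
  "EVP_with_parameter \<psi> \<beta> M \<eta> \<longleftrightarrow>
     standard_EVP M \<eta> \<and>
     (\<forall>d\<ge>1. \<forall>t x :: nat \<Rightarrow> real. (\<forall>j\<in>{1..d}. t j \<in> {0..1} \<and> x j \<le> 0) \<longrightarrow>
        measure M {\<omega>\<in>space M. \<forall>j\<in>{1..d}. \<eta> (t j) \<omega> \<le> x j} =
          exp (- (LBINT s. (MAX j\<in>{1..d}. \<bar>x j\<bar> * scaled \<psi> \<beta> (s - t j)))))"

text \<open>\<open>V\<close> on \<open>N\<close> is a standard generalized Pareto process for the extreme value process
  \<open>\<eta>\<close> on \<open>K\<close>; the two processes need not share a probability space.\<close>

definition standard_GPP ::
    "'b measure \<Rightarrow> (real \<Rightarrow> 'b \<Rightarrow> real) \<Rightarrow> 'c measure \<Rightarrow> (real \<Rightarrow> 'c \<Rightarrow> real) \<Rightarrow> bool" where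
  "standard_GPP N V K \<eta> \<longleftrightarrow>
     prob_space N \<and> continuous_process N V \<and>
     (\<exists>x0>0. \<forall>f\<in>E_minus. sup_norm f \<le> x0 \<longrightarrow>
        process_df N V f = 1 + ln (process_df K \<eta> f))"

text \<open>The law of a process is its law on the product space over \<open>[0,1]\<close>; for continuous
  processes this determines the law as a random element of \<open>C[0,1]\<close>, whose Borel sets are the
  traces of the product sigma-algebra.\<close>

definition sample_path :: "(real \<Rightarrow> 'a \<Rightarrow> real) \<Rightarrow> 'a \<Rightarrow> (real \<Rightarrow> real)" where
  "sample_path X \<omega> = (\<lambda>t\<in>{0..1}. X t \<omega>)"

abbreviation path_space :: "(real \<Rightarrow> real) measure" where
  "path_space \<equiv> PiM {0..1::real} (\<lambda>_. borel)"

definition independent_copies ::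
    "'a measure \<Rightarrow> (nat \<Rightarrow> real \<Rightarrow> 'a \<Rightarrow> real) \<Rightarrow> 'b measure \<Rightarrow> (real \<Rightarrow> 'b \<Rightarrow> real) \<Rightarrow> bool" where
  "independent_copies M X N V \<longleftrightarrow>
     prob_space M \<and>
     (\<forall>i\<ge>1. continuous_process M (X i) \<and>
        distr M path_space (sample_path (X i)) = distr N path_space (sample_path V)) \<and>
     prob_space.indep_vars M (\<lambda>_. path_space) (\<lambda>i. sample_path (X i)) {1..}"

definition Psi_hat :: "(nat \<Rightarrow> real \<Rightarrow> 'a \<Rightarrow> real) \<Rightarrow> real \<Rightarrow> nat \<Rightarrow> 'a \<Rightarrow> real" where
  "Psi_hat X c n \<omega> =
     1 / (2 * \<bar>c\<bar> * real n) * (\<Sum>i=1..n. of_bool (\<forall>t\<in>{0..1}. X i t \<omega> > c))"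

text \<open>\<open>b n\<close> is the (arbitrary, possibly random) value assigned to the estimator when
  \<^const>\<open>quantile\<close> is undefined.\<close>

definition beta_hat ::
    "(real \<Rightarrow> real) \<Rightarrow> (nat \<Rightarrow> real \<Rightarrow> 'a \<Rightarrow> real) \<Rightarrow> (nat \<Rightarrow> 'a \<Rightarrow> real) \<Rightarrow> real \<Rightarrow> nat \<Rightarrow> 'a \<Rightarrow> real" where
  "beta_hat \<psi> X b c n \<omega> =
     (if Psi_hat X c n \<omega> \<in> {0<..<1} then - 2 * quantile \<psi> (Psi_hat X c n \<omega>) else b n \<omega>)"

text \<open>The second parameter is the variance, whereas \<^const>\<open>normal_density\<close> takes the standard
  deviation.\<close>

definition normal_dist :: "real \<Rightarrow> real \<Rightarrow> real measure" where
  "normal_dist a v = density lborel (normal_density a (sqrt v))"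

definition converges_in_distribution ::
    "'a measure \<Rightarrow> (nat \<Rightarrow> 'a \<Rightarrow> real) \<Rightarrow> real measure \<Rightarrow> bool" where
  "converges_in_distribution M Z L \<longleftrightarrow> weak_conv_m (\<lambda>n. distr M borel (Z n)) L"

end

theory Submission
  imports Defs "HOL-Real_Asymp.Real_Asymp"
begin

text \<open>The only property of the process that matters is that, for \<open>c < 0\<close> near \<open>0\<close>, a path stays
  above \<open>c\<close> with probability exactly \<open>2 \<bar>c\<bar> \<Psi>(-\<beta>/2)\<close>, so that the estimator is a scaled mean of
  Bernoulli variables. Evaluating the process distribution functions at functions equal to \<open>c\<close>
  on a finite set and \<open>0\<close> elsewhere gives the finite dimensional distributions of \<open>V\<close> near \<open>0\<close>,
  and by inclusion-exclusion \<open>V\<^sub>0 > c\<close> and \<open>V\<^sub>1 > c\<close> hold together with probability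
  \<open>\<bar>c\<bar> \<integral> min (\<psi>\<^sub>\<beta>(s)) (\<psi>\<^sub>\<beta>(s - 1)) ds = 2 \<bar>c\<bar> \<Psi>(-\<beta>/2)\<close>. Unimodality makes \<open>V\<^sub>t \<le> c\<close> a null
  event given this, for each \<open>t\<close>; continuity of the paths, applied to levels slightly above \<open>c\<close>,
  extends it to all \<open>t\<close> at once. The central limit theorem gives the first limit, and the
  monotone transformation \<open>-2 \<Psi>\<^sup>-\<^sup>1\<close> carries distribution functions over to the second.\<close>

section \<open>Unimodal densities and their distribution functions\<close>

lemma unimodal_densityD:
  assumes "unimodal_density \<psi>"
  shows "continuous_on UNIV \<psi>" "integrable lborel \<psi>" "(LBINT s. \<psi> s) = 1"
    "\<psi> s > 0" "\<psi> (- s) = \<psi> s" "\<psi> \<in> borel_measurable borel"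
  using assms unfolding unimodal_density_def
  by (auto intro: borel_measurable_continuous_onI)

text \<open>Symmetry makes \<open>\<psi>\<close> a function of the absolute value, so monotonicity
  on the half line compares any two points by their distance from 0. Unimodality enters the later
  arguments in this form.\<close>

lemma unimodal_density_antimono_abs:
  assumes "unimodal_density \<psi>" "\<bar>x\<bar> \<le> \<bar>y\<bar>"
  shows "\<psi> y \<le> \<psi> x"
proof -
  have "\<psi> \<bar>z\<bar> = \<psi> z" for z
    using unimodal_densityD(5)[OF assms(1)] by (simp add: abs_if)
  moreover have "\<psi> \<bar>y\<bar> \<le> \<psi> \<bar>x\<bar>"
    using assms unfolding unimodal_density_def by (auto elim!: monotone_onD)
  ultimately show ?thesis by simp
qed

lemma set_integrable_unimodal:
  assumes "unimodal_density \<psi>" "A \<in> sets borel"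
  shows "set_integrable lborel A \<psi>"
  using unimodal_densityD(2)[OF assms(1)] assms(2)
  unfolding set_integrable_def by (intro integrable_mult_indicator) auto

lemma real_distribution_unimodal:
  assumes "unimodal_density \<psi>"
  shows "real_distribution (density lborel \<psi>)"
proof -
  note [measurable] = unimodal_densityD(6)[OF assms]
  have "(\<integral>\<^sup>+ x. ennreal (\<psi> x) \<partial>lborel) = 1"
    using unimodal_densityD[OF assms]
    by (subst nn_integral_eq_integral) (auto intro: less_imp_le)
  then have "prob_space (density lborel \<psi>)"
    by (intro prob_spaceI) (simp add: emeasure_density)
  then show ?thesis
    by (simp add: real_distribution_def real_distribution_axioms_def)
qed

text \<open>Viewed as the cdf of a probability measure, \<open>df \<psi>\<close> inherits its limits
  at infinity and its bounds 0 and 1.\<close>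

lemma df_eq_cdf:
  assumes "unimodal_density \<psi>"
  shows "df \<psi> = cdf (density lborel \<psi>)"
proof
  fix x
  interpret D: real_distribution "density lborel \<psi>"
    by (rule real_distribution_unimodal[OF assms])
  note [measurable] = unimodal_densityD(6)[OF assms]
  have "emeasure (density lborel \<psi>) {..x} = (\<integral>\<^sup>+ s. ennreal (indicator {..x} s * \<psi> s) \<partial>lborel)"
    by (auto simp: emeasure_density mult.commute intro!: nn_integral_cong split: split_indicator)
  also have "\<dots> = ennreal (df \<psi> x)"
    using set_integrable_unimodal[OF assms, of "{..x}"] unimodal_densityD(4)[OF assms]
    unfolding df_def set_lebesgue_integral_def set_integrable_def
    by (subst nn_integral_eq_integral) (auto intro!: AE_I2 mult_nonneg_nonneg intro: less_imp_le)
  finally have "ennreal (cdf (density lborel \<psi>) x) = ennreal (df \<psi> x)"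
    by (simp add: cdf_def D.emeasure_eq_measure)
  moreover have "df \<psi> x \<ge> 0"
    using unimodal_densityD(4)[OF assms] unfolding df_def
    by (auto simp: set_lebesgue_integral_def
      intro!: Bochner_Integration.integral_nonneg mult_nonneg_nonneg intro: less_imp_le)
  ultimately show "df \<psi> x = cdf (density lborel \<psi>) x"
    by (metis D.cdf_nonneg ennreal_inj)
qed

lemma DERIV_df:
  assumes "unimodal_density \<psi>"
  shows "(df \<psi> has_real_derivative \<psi> x) (at x)"
proof -
  \<comment> \<open>Splitting at \<open>x - 1\<close> leaves a constant plus an integral over a
    compact interval with \<open>x\<close> in its interior, to which the fundamental theorem of
    calculus applies.\<close>
  have *: "df \<psi> u = df \<psi> (x - 1) + integral {x - 1..u} \<psi>" if "u \<ge> x - 1" for u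
  proof -
    have "df \<psi> u = (LBINT s:{..x - 1} \<union> {x - 1<..u}. \<psi> s)"
      using that unfolding df_def by (intro arg_cong2[where f="set_lebesgue_integral lborel"]) auto
    also have "\<dots> = df \<psi> (x - 1) + (LBINT s:{x - 1<..u}. \<psi> s)"
      unfolding df_def by (intro set_integral_Un set_integrable_unimodal[OF assms]) auto
    also have "(LBINT s:{x - 1<..u}. \<psi> s) = (LBINT s:{x - 1..u}. \<psi> s)"
      using interval_integral_Ioc[of "x-1" u \<psi>] interval_integral_Icc[of "x-1" u \<psi>] that by simp
    also have "\<dots> = integral {x - 1..u} \<psi>"
      by (intro set_borel_integral_eq_integral set_integrable_unimodal[OF assms]) auto
    finally show ?thesis .
  qed
  have "continuous_on {x - 1..x + 1} \<psi>"
    using unimodal_densityD(1)[OF assms] by (rule continuous_on_subset) auto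
  from integral_has_real_derivative[OF this, of x]
  have "((\<lambda>u. df \<psi> (x - 1) + integral {x - 1..u} \<psi>) has_real_derivative \<psi> x) (at x within {x - 1..x + 1})"
    by (auto intro!: derivative_eq_intros)
  then have "(df \<psi> has_real_derivative \<psi> x) (at x within {x - 1..x + 1})"
    by (rule has_field_derivative_transform_within[where d=1]) (simp_all flip: *)
  moreover have "at x within {x - 1..x + 1} = at x"
    by (rule at_within_Icc_at) auto
  ultimately show ?thesis by simp
qed

lemma isCont_df: "unimodal_density \<psi> \<Longrightarrow> isCont (df \<psi>) x"
  using DERIV_df DERIV_isCont by blast

lemma strict_mono_df:
  assumes "unimodal_density \<psi>"
  shows "strict_mono (df \<psi>)"
proof (rule strict_monoI)
  fix x y :: real assume "x < y"
  then show "df \<psi> x < df \<psi> y"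
    by (rule DERIV_pos_imp_increasing)
       (use DERIV_df[OF assms] unimodal_densityD(4)[OF assms] in blast)
qed

lemma df_tendsto:
  assumes "unimodal_density \<psi>"
  shows "(df \<psi> \<longlongrightarrow> 0) at_bot" "(df \<psi> \<longlongrightarrow> 1) at_top"
proof -
  interpret D: real_distribution "density lborel \<psi>"
    by (rule real_distribution_unimodal[OF assms])
  show "(df \<psi> \<longlongrightarrow> 0) at_bot" "(df \<psi> \<longlongrightarrow> 1) at_top"
    unfolding df_eq_cdf[OF assms] by (rule D.cdf_lim_at_bot, rule D.cdf_lim_at_top_prob)
qed

lemma set_integral_atLeast_eq_df:
  assumes "unimodal_density \<psi>"
  shows "(LBINT s:{x..}. \<psi> s) = df \<psi> (- x)"
  unfolding df_def set_lebesgue_integral_def using unimodal_densityD(5)[OF assms]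
  by (subst lborel_integral_real_affine[where c="-1" and t=0])
     (auto intro!: Bochner_Integration.integral_cong split: split_indicator)

lemma set_integral_lessThan_eq_df:
  assumes "unimodal_density \<psi>"
  shows "(LBINT s:{..<x}. \<psi> s) = df \<psi> x"
  unfolding df_def set_lebesgue_integral_def
  using unimodal_densityD(6)[OF assms] AE_lborel_singleton[of x]
  by (intro integral_cong_AE) (auto split: split_indicator)

lemma df_minus:
  assumes "unimodal_density \<psi>"
  shows "df \<psi> (- x) = 1 - df \<psi> x"
proof -
  have "{..<x} \<union> {x..} = UNIV" by auto
  then have "1 = (LBINT s:{..<x} \<union> {x..}. \<psi> s)"
    using unimodal_densityD(3)[OF assms] by (simp add: set_lebesgue_integral_def)
  also have "\<dots> = df \<psi> x + df \<psi> (- x)"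
    by (subst set_integral_Un)
       (auto intro!: set_integrable_unimodal[OF assms]
         simp: set_integral_atLeast_eq_df[OF assms] set_integral_lessThan_eq_df[OF assms])
  finally show ?thesis by simp
qed

lemma df_in_01:
  assumes "unimodal_density \<psi>"
  shows "0 < df \<psi> x" "df \<psi> x < 1"
proof -
  interpret D: real_distribution "density lborel \<psi>"
    by (rule real_distribution_unimodal[OF assms])
  have "0 \<le> df \<psi> (x - 1)" "df \<psi> (x + 1) \<le> 1"
    by (simp_all add: df_eq_cdf[OF assms] D.cdf_nonneg D.cdf_bounded_prob)
  moreover have "df \<psi> (x - 1) < df \<psi> x" "df \<psi> x < df \<psi> (x + 1)"
    using strict_mono_df[OF assms] by (auto elim!: strict_monoD)
  ultimately show "0 < df \<psi> x" "df \<psi> x < 1" by auto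
qed

text \<open>The limits at infinity and the intermediate value theorem give a preimage of
  \<open>q\<close>; strict monotonicity makes it unique and equal to the infimum. The equivalence
  later turns events about the quantile of an estimator into events about the estimator
  itself.\<close>

lemma le_quantile_iff:
  assumes "unimodal_density \<psi>" "q \<in> {0<..<1}"
  shows "t \<le> quantile \<psi> q \<longleftrightarrow> df \<psi> t \<le> q"
proof -
  obtain a where a: "df \<psi> a < q"
    using order_tendstoD(2)[OF df_tendsto(1)[OF assms(1)], of q] assms(2)
    by (auto simp: eventually_at_bot_linorder)
  obtain b where b: "q < df \<psi> b"
    using order_tendstoD(1)[OF df_tendsto(2)[OF assms(1)], of q] assms(2)
    by (auto simp: eventually_at_top_linorder)
  have mono: "df \<psi> x \<le> df \<psi> y \<longleftrightarrow> x \<le> y" for x y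
    by (rule strict_mono_less_eq[OF strict_mono_df[OF assms(1)]])
  have "a \<le> b" using a b mono by (meson less_le_trans less_imp_le not_le)
  then obtain s where s: "df \<psi> s = q"
    using IVT[of "df \<psi>" a q b] a b isCont_df[OF assms(1)] by auto
  have "quantile \<psi> q = s"
    by (simp add: quantile_def s[symmetric] mono atLeast_def[symmetric])
  with mono[of t s] s show ?thesis by simp
qed

section \<open>Rescaling, and the overlap of a density with its unit shift\<close>

lemma unimodal_density_scaled:
  assumes "unimodal_density \<psi>" "\<beta> > 0"
  shows "unimodal_density (scaled \<psi> \<beta>)"
  unfolding unimodal_density_def
proof (intro conjI allI)
  note [measurable] = unimodal_densityD(6)[OF assms(1)]
  have "continuous_on UNIV (\<lambda>s. \<beta> * \<psi> (\<beta> * s))"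
    by (intro continuous_intros continuous_on_compose2[OF unimodal_densityD(1)[OF assms(1)]]) auto
  then show "continuous_on UNIV (scaled \<psi> \<beta>)" by (simp add: scaled_def[abs_def])
  show "integrable lborel (scaled \<psi> \<beta>)"
    using lborel_integrable_real_affine[OF unimodal_densityD(2)[OF assms(1)], of \<beta> 0] assms(2)
    by (simp add: scaled_def[abs_def])
  show "(LBINT s. scaled \<psi> \<beta> s) = 1"
    using lborel_integral_real_affine[of \<beta> \<psi> 0] unimodal_densityD(3)[OF assms(1)] assms(2)
    by (simp add: scaled_def[abs_def])
  show "antimono_on {0..} (scaled \<psi> \<beta>)"
    using assms(2) by (intro monotone_onI)
      (auto simp: scaled_def intro!: mult_left_mono unimodal_density_antimono_abs[OF assms(1)])
qed (use assms unimodal_densityD(4,5)[OF assms(1)] in \<open>auto simp: scaled_def\<close>)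

lemma df_scaled:
  assumes "\<beta> > 0"
  shows "df (scaled \<psi> \<beta>) x = df \<psi> (\<beta> * x)"
proof -
  have "df (scaled \<psi> \<beta>) x = (LBINT s. \<beta> * (indicator {..\<beta> * x} (\<beta> * s) * \<psi> (\<beta> * s)))"
    unfolding df_def set_lebesgue_integral_def using assms
    by (intro Bochner_Integration.integral_cong) (auto simp: scaled_def split: split_indicator)
  also have "\<dots> = df \<psi> (\<beta> * x)"
    unfolding df_def set_lebesgue_integral_def using assms
    by (subst (2) lborel_integral_real_affine[where c=\<beta> and t=0]) simp_all
  finally show ?thesis .
qed

text \<open>The normal limit law thus falls under the same theory: continuity, tails and symmetry of
  its distribution function come from the lemmas on \<open>df\<close>.\<close>

lemma unimodal_density_std_normal: "unimodal_density std_normal_density"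
  unfolding unimodal_density_def
proof (intro conjI allI)
  show "continuous_on UNIV std_normal_density"
    unfolding std_normal_density_def[abs_def] by (intro continuous_intros) auto
  show "antimono_on {0..} std_normal_density"
    by (intro monotone_onI) (auto simp: std_normal_density_def divide_right_mono power_mono)
qed (auto simp: normal_density_pos std_normal_density_def)

text \<open>The two curves cross at \<open>1/2\<close>. To the right of it \<open>s\<close> is at
  least as far from 0 as from 1, so the minimum is \<open>\<phi> s\<close>; to the left it is
  \<open>\<phi> (s - 1)\<close>. Each side contributes a tail of mass
  \<open>df \<phi> (- 1 / 2)\<close>.\<close>

lemma integral_min_shift:
  assumes "unimodal_density \<phi>"
  shows "(LBINT s. min (\<phi> s) (\<phi> (s - 1))) = 2 * df \<phi> (- 1 / 2)"
proof -
  have "integrable lborel (\<lambda>s. \<phi> (s - 1))"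
    using lborel_integrable_real_affine[OF unimodal_densityD(2)[OF assms], of 1 "-1"] by simp
  then have int: "set_integrable lborel {..<1/2} (\<lambda>s. \<phi> (s - 1))"
    unfolding set_integrable_def by (intro integrable_mult_indicator) auto
  have "(LBINT s. min (\<phi> s) (\<phi> (s - 1))) =
      (LBINT s. indicator {1/2..} s *\<^sub>R \<phi> s + indicator {..<1/2} s *\<^sub>R \<phi> (s - 1))"
    by (intro Bochner_Integration.integral_cong)
       (auto split: split_indicator simp: min_def intro!: antisym
         unimodal_density_antimono_abs[OF assms])
  also have "\<dots> = (LBINT s:{1/2..}. \<phi> s) + (LBINT s:{..<1/2}. \<phi> (s - 1))"
    using set_integrable_unimodal[OF assms, of "{1/2..}"] int
    unfolding set_lebesgue_integral_def set_integrable_def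
    by (intro Bochner_Integration.integral_add) auto
  also have "(LBINT s:{..<1/2}. \<phi> (s - 1)) = (LBINT s:{..<-1/2}. \<phi> s)"
    unfolding set_lebesgue_integral_def
    by (subst (2) lborel_integral_real_affine[where c=1 and t="-1"])
       (auto intro!: Bochner_Integration.integral_cong split: split_indicator)
  finally show ?thesis
    by (simp add: set_integral_atLeast_eq_df[OF assms] set_integral_lessThan_eq_df[OF assms])
qed

section \<open>Convergence of distribution functions and the delta method\<close>

lemma cdf_normal_dist:
  assumes "v > 0"
  shows "cdf (normal_dist 0 v) x = df std_normal_density (x / sqrt v)"
proof -
  have *: "normal_density 0 (sqrt v) = scaled std_normal_density (1 / sqrt v)"
    using assms by (simp add: fun_eq_iff scaled_def normal_density_def real_sqrt_mult
        power_divide field_simps)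
  show ?thesis
    using unimodal_density_scaled[OF unimodal_density_std_normal, of "1 / sqrt v"] assms
    by (simp add: normal_dist_def * df_scaled flip: df_eq_cdf)
qed

lemma cdf_std_normal_distribution: "cdf std_normal_distribution = df std_normal_density"
  by (simp add: df_eq_cdf[OF unimodal_density_std_normal])

lemma cdf_distr:
  assumes "Z \<in> borel_measurable M"
  shows "cdf (distr M borel Z) x = measure M {\<omega>\<in>space M. Z \<omega> \<le> x}"
  using assms by (auto simp: cdf_def measure_distr intro!: arg_cong[where f="measure M"])

text \<open>The limiting distribution function is continuous everywhere, so weak convergence means
  convergence at every point.\<close>

lemma converges_in_distribution_iff:
  assumes "\<And>n. Z n \<in> borel_measurable M" "v > 0"
  shows "converges_in_distribution M Z (normal_dist 0 v) \<longleftrightarrow>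
    (\<forall>x. (\<lambda>n. measure M {\<omega>\<in>space M. Z n \<omega> \<le> x}) \<longlonglongrightarrow> df std_normal_density (x / sqrt v))"
proof -
  have cdf: "cdf (normal_dist 0 v) = (\<lambda>x. df std_normal_density (x / sqrt v))"
    using cdf_normal_dist[OF assms(2)] by auto
  have "isCont (\<lambda>x. df std_normal_density (x / sqrt v)) x" for x
    using assms(2) by (intro isCont_o2[OF _ isCont_df[OF unimodal_density_std_normal]]) auto
  then show ?thesis
    by (simp add: converges_in_distribution_def weak_conv_m_def weak_conv_def cdf cdf_distr[OF assms(1)])
qed

text \<open>Eventually \<open>Y n\<close> lies between the fixed points \<open>y - d/2\<close> and
  \<open>y + d/2\<close>; monotonicity of \<open>F n\<close> compares with the values there, and
  continuity of \<open>G\<close> at \<open>y\<close> makes their limits close to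
  \<open>G y\<close>.\<close>

lemma LIMSEQ_mono_moving_point:
  fixes F :: "nat \<Rightarrow> real \<Rightarrow> real"
  assumes mono: "\<And>n. mono (F n)" and F: "\<And>x. (\<lambda>n. F n x) \<longlonglongrightarrow> G x"
    and G: "isCont G y" and y: "Y \<longlonglongrightarrow> y"
  shows "(\<lambda>n. F n (Y n)) \<longlonglongrightarrow> G y"
proof (rule order_tendstoI)
  fix a assume "a < G y"
  then have "\<forall>\<^sub>F u in at y. a < G u"
    using G by (auto simp: isCont_def order_tendsto_iff)
  then obtain d where d: "d > 0" "\<And>u. u \<noteq> y \<Longrightarrow> dist u y < d \<Longrightarrow> a < G u"
    by (auto simp: eventually_at)
  from d(1) d(2)[of "y - d/2"] have "a < G (y - d/2)" by (simp add: dist_real_def)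
  then have "\<forall>\<^sub>F n in sequentially. a < F n (y - d/2)"
    by (rule order_tendstoD(1)[OF F])
  moreover have "\<forall>\<^sub>F n in sequentially. y - d/2 < Y n"
    using d(1) by (intro order_tendstoD(1)[OF y]) simp
  ultimately show "\<forall>\<^sub>F n in sequentially. a < F n (Y n)"
    by eventually_elim (use mono in \<open>meson less_le_trans less_imp_le monoD\<close>)
next
  fix a assume "a > G y"
  then have "\<forall>\<^sub>F u in at y. a > G u"
    using G by (auto simp: isCont_def order_tendsto_iff)
  then obtain d where d: "d > 0" "\<And>u. u \<noteq> y \<Longrightarrow> dist u y < d \<Longrightarrow> a > G u"
    by (auto simp: eventually_at)
  from d(1) d(2)[of "y + d/2"] have "a > G (y + d/2)" by (simp add: dist_real_def)
  then have "\<forall>\<^sub>F n in sequentially. a > F n (y + d/2)"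
    by (rule order_tendstoD(2)[OF F])
  moreover have "\<forall>\<^sub>F n in sequentially. y + d/2 > Y n"
    using d(1) by (intro order_tendstoD(2)[OF y]) simp
  ultimately show "\<forall>\<^sub>F n in sequentially. a > F n (Y n)"
    by eventually_elim (use mono in \<open>meson le_less_trans less_imp_le monoD\<close>)
qed

section \<open>Moving thresholds, tail events and the delta method\<close>

context prob_space
begin

context
  fixes Z :: "nat \<Rightarrow> 'a \<Rightarrow> real" and G :: "real \<Rightarrow> real"
  assumes meas [measurable]: "\<And>n. Z n \<in> borel_measurable M"
    and conv: "\<And>x. (\<lambda>n. prob {\<omega>\<in>space M. Z n \<omega> \<le> x}) \<longlonglongrightarrow> G x"
begin

lemma mono_prob_le: "mono (\<lambda>x. prob {\<omega>\<in>space M. Z n \<omega> \<le> x})"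
  by (intro monoI finite_measure_mono) auto

text \<open>The strict event is squeezed between two non-strict ones, with thresholds
  \<open>Y n\<close> and \<open>Y n - 1/(n+1)\<close>, both converging to \<open>y\<close>.\<close>

lemma prob_less_tendsto:
  assumes "isCont G y" "Y \<longlonglongrightarrow> y"
  shows "(\<lambda>n. prob {\<omega>\<in>space M. Z n \<omega> < Y n}) \<longlonglongrightarrow> G y"
proof (rule tendsto_sandwich[where f="\<lambda>n. prob {\<omega>\<in>space M. Z n \<omega> \<le> Y n - inverse (Suc n)}"
      and h="\<lambda>n. prob {\<omega>\<in>space M. Z n \<omega> \<le> Y n}"])
  show "(\<lambda>n. prob {\<omega>\<in>space M. Z n \<omega> \<le> Y n}) \<longlonglongrightarrow> G y"
    by (rule LIMSEQ_mono_moving_point[OF mono_prob_le conv assms])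
  have "(\<lambda>n. Y n - inverse (Suc n)) \<longlonglongrightarrow> y"
    using tendsto_diff[OF assms(2) LIMSEQ_inverse_real_of_nat] by simp
  then show "(\<lambda>n. prob {\<omega>\<in>space M. Z n \<omega> \<le> Y n - inverse (Suc n)}) \<longlonglongrightarrow> G y"
    by (rule LIMSEQ_mono_moving_point[OF mono_prob_le conv assms(1)])
  have "Z n \<omega> < Y n" if "Z n \<omega> \<le> Y n - inverse (1 + real n)" for n \<omega>
    using that inverse_positive_iff_positive[of "1 + real n"] by linarith
  then show "\<forall>\<^sub>F n in sequentially. prob {\<omega>\<in>space M. Z n \<omega> \<le> Y n - inverse (Suc n)}
      \<le> prob {\<omega>\<in>space M. Z n \<omega> < Y n}"
    by (intro always_eventually allI finite_measure_mono) auto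
qed (auto intro!: always_eventually finite_measure_mono)

text \<open>Together with \<open>prob_ge_at_top\<close> this shows that an estimator whose limit is
  inside \<open>(0,1)\<close> leaves that interval with vanishing probability.\<close>

lemma prob_le_at_bot:
  assumes "(G \<longlongrightarrow> 0) at_bot" "filterlim Y at_bot sequentially"
  shows "(\<lambda>n. prob {\<omega>\<in>space M. Z n \<omega> \<le> Y n}) \<longlonglongrightarrow> 0"
proof (rule order_tendstoI)
  fix e :: real assume "e > 0"
  from order_tendstoD(2)[OF assms(1) this] obtain u where "G u < e"
    by (auto simp: eventually_at_bot_linorder)
  then have "\<forall>\<^sub>F n in sequentially. prob {\<omega>\<in>space M. Z n \<omega> \<le> u} < e"
    by (rule order_tendstoD(2)[OF conv])
  moreover have "\<forall>\<^sub>F n in sequentially. Y n \<le> u"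
    using assms(2) by (simp add: filterlim_at_bot)
  ultimately show "\<forall>\<^sub>F n in sequentially. prob {\<omega>\<in>space M. Z n \<omega> \<le> Y n} < e"
  proof eventually_elim
    case (elim n)
    then show ?case
      using monoD[OF mono_prob_le[of n] elim(2)] by simp
  qed
qed (auto intro!: always_eventually less_le_trans[OF _ measure_nonneg])

lemma prob_ge_at_top:
  assumes "(G \<longlongrightarrow> 1) at_top" "filterlim Y at_top sequentially"
  shows "(\<lambda>n. prob {\<omega>\<in>space M. Y n \<le> Z n \<omega>}) \<longlonglongrightarrow> 0"
proof (rule order_tendstoI)
  fix e :: real assume "e > 0"
  then have "1 - e < 1" by simp
  from order_tendstoD(1)[OF assms(1) this] obtain u where "1 - e < G u"
    by (auto simp: eventually_at_top_linorder)
  then have "\<forall>\<^sub>F n in sequentially. prob {\<omega>\<in>space M. Z n \<omega> \<le> u} > 1 - e"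
    by (rule order_tendstoD(1)[OF conv])
  moreover have "\<forall>\<^sub>F n in sequentially. Y n > u"
    using assms(2) by (simp add: filterlim_at_top_dense)
  ultimately show "\<forall>\<^sub>F n in sequentially. prob {\<omega>\<in>space M. Y n \<le> Z n \<omega>} < e"
  proof eventually_elim
    case (elim n)
    have "prob {\<omega>\<in>space M. Y n \<le> Z n \<omega>} \<le> prob (space M - {\<omega>\<in>space M. Z n \<omega> \<le> u})"
      using elim(2) by (intro finite_measure_mono) auto
    also have "\<dots> = 1 - prob {\<omega>\<in>space M. Z n \<omega> \<le> u}" by (rule prob_compl) simp
    finally show ?case using elim(1) by simp
  qed
qed (auto intro!: always_eventually less_le_trans[OF _ measure_nonneg])

end

text \<open>The delta method for \<open>-2 \<cdot> quantile\<close>, read off distribution functions: \<open>B n \<le> u\<close> is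
  the same event as \<open>df \<psi> (- u / 2) \<le> T n\<close>.\<close>

lemma prob_quantile_estimator_tendsto:
  fixes T B :: "nat \<Rightarrow> 'a \<Rightarrow> real"
  assumes \<psi>: "unimodal_density \<psi>" and "\<sigma> > 0"
    and [measurable]: "\<And>n. T n \<in> borel_measurable M" "\<And>n. B n \<in> borel_measurable M"
    and conv: "\<And>x. (\<lambda>n. prob {\<omega>\<in>space M. sqrt n * (T n \<omega> - df \<psi> a) \<le> x})
        \<longlonglongrightarrow> df std_normal_density (x / \<sigma>)"
    and B: "\<And>n \<omega>. T n \<omega> \<in> {0<..<1} \<Longrightarrow> B n \<omega> = - 2 * quantile \<psi> (T n \<omega>)"
  shows "(\<lambda>n. prob {\<omega>\<in>space M. sqrt n * (B n \<omega> - (- 2 * a)) \<le> x})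
      \<longlonglongrightarrow> df std_normal_density (x / (2 * \<sigma> / \<psi> a))"
proof -
  define Z where "Z n \<omega> = sqrt n * (T n \<omega> - df \<psi> a)" for n \<omega>
  have [measurable]: "Z n \<in> borel_measurable M" for n
    unfolding Z_def by measurable
  define G where "G x = df std_normal_density (x / \<sigma>)" for x
  have conv: "(\<lambda>n. prob {\<omega>\<in>space M. Z n \<omega> \<le> x}) \<longlonglongrightarrow> G x" for x
    using conv by (simp add: Z_def G_def)
  have G_cont: "isCont G y" for y
    unfolding G_def using \<open>\<sigma> > 0\<close>
    by (intro isCont_o2[OF _ isCont_df[OF unimodal_density_std_normal]]) auto
  have G_bot: "(G \<longlongrightarrow> 0) at_bot"
    unfolding G_def using \<open>\<sigma> > 0\<close>
    by (intro filterlim_compose[OF df_tendsto(1)[OF unimodal_density_std_normal]]) real_asymp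
  have G_top: "(G \<longlongrightarrow> 1) at_top"
    unfolding G_def using \<open>\<sigma> > 0\<close>
    by (intro filterlim_compose[OF df_tendsto(2)[OF unimodal_density_std_normal]]) real_asymp
  \<comment> \<open>For \<open>T n\<close> in \<open>(0,1)\<close>, the event that the rescaled
    error of \<open>B n\<close> is at most \<open>x\<close> says that the quantile is at least
    \<open>a - x / (2 * sqrt n)\<close>. \<open>Y n\<close> is the threshold for \<open>Z n\<close>
    that this amounts to; it is a difference quotient with increment \<open>1 / sqrt n\<close>, so
    it converges by differentiability.\<close>
  define Y where "Y n = sqrt n * (df \<psi> (a - x / 2 * (1 / sqrt n)) - df \<psi> a)" for n :: nat
  have "((\<lambda>h. df \<psi> (a - x / 2 * h)) has_real_derivative (\<psi> a * - (x / 2))) (at 0)"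
    using DERIV_df[OF \<psi>, of a] by (intro DERIV_chain') (auto intro!: derivative_eq_intros)
  then have lim: "((\<lambda>h. (df \<psi> (a - x / 2 * h) - df \<psi> a) / h) \<longlongrightarrow> \<psi> a * - (x / 2)) (at 0)"
    by (simp add: DERIV_def)
  have "filterlim (\<lambda>n::nat. 1 / sqrt n) (at 0) sequentially" by real_asymp
  from filterlim_compose[OF lim this] have Y: "Y \<longlonglongrightarrow> - (\<psi> a * x / 2)"
    by (simp add: Y_def[abs_def] mult.commute)
  have G_minus: "1 - G (- (\<psi> a * x / 2)) = df std_normal_density (x / (2 * \<sigma> / \<psi> a))"
    by (simp add: G_def df_minus[OF unimodal_density_std_normal] mult_ac)
  have ge: "prob {\<omega>\<in>space M. Y n \<le> Z n \<omega>} = 1 - prob {\<omega>\<in>space M. Z n \<omega> < Y n}" for n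
    by (subst prob_compl[symmetric]) (auto intro!: arg_cong[where f=prob])
  have lim_Y: "(\<lambda>n. prob {\<omega>\<in>space M. Y n \<le> Z n \<omega>}) \<longlonglongrightarrow> df std_normal_density (x / (2 * \<sigma> / \<psi> a))"
    unfolding ge G_minus[symmetric]
    by (intro tendsto_intros prob_less_tendsto[OF _ conv G_cont Y]) measurable
  \<comment> \<open>\<open>R n\<close> bounds the probability that \<open>T n\<close> is outside
    \<open>(0,1)\<close>, where nothing is known about \<open>B n\<close>: its two terms are the
    events \<open>T n \<le> 0\<close> and \<open>T n \<ge> 1\<close>, expressed through
    \<open>Z n\<close>.\<close>
  define R where "R n = prob {\<omega>\<in>space M. Z n \<omega> \<le> - sqrt n * df \<psi> a} +
    prob {\<omega>\<in>space M. sqrt n * (1 - df \<psi> a) \<le> Z n \<omega>}" for n :: nat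
  have lims: "filterlim (\<lambda>n::nat. - sqrt n * p) at_bot sequentially"
      "filterlim (\<lambda>n::nat. sqrt n * p) at_top sequentially" if "p > 0" for p :: real
    using that by real_asymp+
  have "R \<longlonglongrightarrow> 0 + 0"
    unfolding R_def
  proof (rule tendsto_add)
    show "(\<lambda>n. prob {\<omega>\<in>space M. Z n \<omega> \<le> - sqrt n * df \<psi> a}) \<longlonglongrightarrow> 0"
      by (rule prob_le_at_bot[OF _ conv G_bot], measurable)
         (rule lims, use df_in_01[OF \<psi>, of a] in simp)
    show "(\<lambda>n. prob {\<omega>\<in>space M. sqrt n * (1 - df \<psi> a) \<le> Z n \<omega>}) \<longlonglongrightarrow> 0"
      by (rule prob_ge_at_top[OF _ conv G_top], measurable)
         (rule lims, use df_in_01[OF \<psi>, of a] in simp)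
  qed
  then have R: "R \<longlonglongrightarrow> 0" by simp
  define A where "A n = {\<omega>\<in>space M. sqrt n * (B n \<omega> - (- 2 * a)) \<le> x}" for n :: nat
  define A' where "A' n = {\<omega>\<in>space M. Y n \<le> Z n \<omega>}" for n :: nat
  define E where "E n = {\<omega>\<in>space M. Z n \<omega> \<le> - sqrt n * df \<psi> a} \<union>
    {\<omega>\<in>space M. sqrt n * (1 - df \<psi> a) \<le> Z n \<omega>}" for n :: nat
  have [measurable]: "A n \<in> events" "A' n \<in> events" "E n \<in> events" for n
    unfolding A_def A'_def E_def by measurable
  have iff: "\<omega> \<in> A n \<longleftrightarrow> \<omega> \<in> A' n" if "n > 0" "\<omega> \<in> space M" "\<omega> \<notin> E n" for n \<omega>
  proof -
    have sn: "sqrt n > 0" using that by simp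
    have "- df \<psi> a < T n \<omega> - df \<psi> a" "T n \<omega> - df \<psi> a < 1 - df \<psi> a"
      using that mult_less_cancel_left_pos[OF sn, of "- df \<psi> a" "T n \<omega> - df \<psi> a"]
        mult_less_cancel_left_pos[OF sn, of "T n \<omega> - df \<psi> a" "1 - df \<psi> a"]
      by (auto simp: E_def Z_def not_le)
    then have T: "T n \<omega> \<in> {0<..<1}" by auto
    have "sqrt n * (B n \<omega> - (- 2 * a)) \<le> x \<longleftrightarrow> a - x / 2 * (1 / sqrt n) \<le> quantile \<psi> (T n \<omega>)"
      using sn by (simp add: B[OF T] field_simps)
    also have "\<dots> \<longleftrightarrow> df \<psi> (a - x / 2 * (1 / sqrt n)) - df \<psi> a \<le> T n \<omega> - df \<psi> a"
      by (simp only: le_quantile_iff[OF \<psi> T]) simp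
    also have "\<dots> \<longleftrightarrow> Y n \<le> Z n \<omega>"
      unfolding Y_def Z_def by (rule mult_le_cancel_left_pos[OF sn, symmetric])
    finally show ?thesis using that by (auto simp: A_def A'_def)
  qed
  have E_le: "prob (E n) \<le> R n" for n
    unfolding E_def R_def by (rule measure_Un_le) auto
  \<comment> \<open>The events \<open>A n\<close> and \<open>A' n\<close> differ only inside
    \<open>E n\<close>, so their probabilities have the same limit.\<close>
  have "prob (A n) \<le> prob (A' n) + R n \<and> prob (A' n) - R n \<le> prob (A n)" if "n > 0" for n
  proof -
    have "A n \<subseteq> A' n \<union> E n" "A' n \<subseteq> A n \<union> E n"
      using iff[OF that] by (auto simp: A_def A'_def)
    then have "prob (A n) \<le> prob (A' n \<union> E n)" "prob (A' n) \<le> prob (A n \<union> E n)"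
      by (auto intro!: finite_measure_mono)
    moreover have "prob (A' n \<union> E n) \<le> prob (A' n) + prob (E n)"
      "prob (A n \<union> E n) \<le> prob (A n) + prob (E n)"
      by (auto intro!: measure_Un_le)
    ultimately show ?thesis using E_le[of n] by linarith
  qed
  then have ev: "\<forall>\<^sub>F n in sequentially. prob (A n) \<le> prob (A' n) + R n"
      "\<forall>\<^sub>F n in sequentially. prob (A' n) - R n \<le> prob (A n)"
    by (auto intro!: eventually_mono[OF eventually_gt_at_top[of 0]])
  have "(\<lambda>n. prob (A n)) \<longlonglongrightarrow> df std_normal_density (x / (2 * \<sigma> / \<psi> a))"
    using tendsto_sandwich[OF ev(2,1)] tendsto_diff[OF lim_Y R] tendsto_add[OF lim_Y R]
    by (simp add: A'_def)
  then show ?thesis by (simp add: A_def)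
qed

end

section \<open>Exceedance probabilities of generalized Pareto processes\<close>

lemma continuous_processD:
  assumes "continuous_process M X"
  shows "t \<in> {0..1} \<Longrightarrow> X t \<in> borel_measurable M"
    "\<omega> \<in> space M \<Longrightarrow> continuous_on {0..1} (\<lambda>t. X t \<omega>)"
  using assms unfolding continuous_process_def by auto

text \<open>The open interval is used because an open set met with a dense set keeps its closure,
  here all of \<open>[0,1]\<close>.\<close>

definition rat01 :: "real set" where
  "rat01 = {0<..<1} \<inter> \<rat>"

lemma countable_rat01: "countable rat01"
  by (simp add: rat01_def countable_rat)

lemma rat01_subset: "rat01 \<subseteq> {0..1}"
  by (auto simp: rat01_def)

lemma closure_rat01: "closure rat01 = {0..1}"
  using closure_open_Int_superset[of "{0<..<1::real}" "\<rat>"]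
  by (simp add: rat01_def Rats_closure_real)

lemma all_le_iff_rat01:
  fixes f :: "real \<Rightarrow> real"
  assumes "continuous_on {0..1} f"
  shows "(\<forall>t\<in>{0..1}. f t \<le> a) \<longleftrightarrow> (\<forall>q\<in>rat01. f q \<le> a)"
    "(\<forall>t\<in>{0..1}. a \<le> f t) \<longleftrightarrow> (\<forall>q\<in>rat01. a \<le> f q)"
  using continuous_le_on_closure[of rat01 f _ a] continuous_ge_on_closure[of rat01 f _ a]
    assms rat01_subset by (auto simp: closure_rat01)

text \<open>A strict inequality on a dense set need not survive at the limit points. By compactness
  a continuous \<open>f\<close> attains its minimum, so exceeding \<open>c\<close> everywhere is the
  same as exceeding it by a uniform margin, and that condition is closed.\<close>

lemma all_greater_iff_rat01:
  fixes f :: "real \<Rightarrow> real"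
  assumes "continuous_on {0..1} f"
  shows "(\<forall>t\<in>{0..1}. c < f t) \<longleftrightarrow> (\<exists>k. \<forall>q\<in>rat01. c + inverse (Suc k) \<le> f q)"
proof
  assume *: "\<forall>t\<in>{0..1}. c < f t"
  obtain s where s: "s \<in> {0..1}" "\<forall>t\<in>{0..1}. f s \<le> f t"
    using continuous_attains_inf[OF _ _ assms] by auto
  obtain k where "inverse (Suc k) < f s - c"
    using reals_Archimedean[of "f s - c"] * s by auto
  then have "\<forall>t\<in>{0..1}. c + inverse (Suc k) \<le> f t"
    using s(2) by force
  then show "\<exists>k. \<forall>q\<in>rat01. c + inverse (Suc k) \<le> f q"
    using rat01_subset by blast
next
  assume "\<exists>k. \<forall>q\<in>rat01. c + inverse (Suc k) \<le> f q"
  then obtain k where "\<forall>t\<in>{0..1}. c + inverse (Suc k) \<le> f t"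
    using all_le_iff_rat01(2)[OF assms] by blast
  moreover have "c < c + inverse (Suc k)" by simp
  ultimately show "\<forall>t\<in>{0..1}. c < f t" by (meson less_le_trans)
qed

text \<open>The condition involves only countably many coordinates and hence is measurable in the
  product space; on continuous paths it says that the path stays above \<open>c\<close>. Equality of
  laws and independence of sample paths thereby pass to these events.\<close>

definition paths_above :: "real \<Rightarrow> (real \<Rightarrow> real) set" where
  "paths_above c = {w\<in>space path_space. \<exists>k. \<forall>q\<in>rat01. c + inverse (Suc k) \<le> w q}"

lemma sets_paths_above [measurable]: "paths_above c \<in> sets path_space"
proof -
  have [measurable]: "(\<lambda>w. w q) \<in> borel_measurable path_space" if "q \<in> rat01" for q
    using that rat01_subset by (intro measurable_component_singleton) auto
  have "{w\<in>space path_space. \<forall>q\<in>rat01. c + inverse (Suc k) \<le> w q} \<in> sets path_space" for k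
    by (intro sets.sets_Collect_countable_All' countable_rat01) measurable
  then show ?thesis
    unfolding paths_above_def by (intro sets.sets_Collect_countable_Ex)
qed

lemma measurable_sample_path [measurable]:
  assumes "continuous_process M X"
  shows "sample_path X \<in> measurable M path_space"
  unfolding sample_path_def[abs_def]
  by (intro measurable_restrict continuous_processD(1)[OF assms])

lemma sample_path_in_paths_above:
  assumes "continuous_process M X" "\<omega> \<in> space M"
  shows "sample_path X \<omega> \<in> paths_above c \<longleftrightarrow> (\<forall>t\<in>{0..1}. c < X t \<omega>)"
proof -
  have "sample_path X \<omega> \<in> space path_space"
    using measurable_space[OF measurable_sample_path[OF assms(1)] assms(2)] .
  moreover have "sample_path X \<omega> q = X q \<omega>" if "q \<in> rat01" for q
    using that rat01_subset by (auto simp: sample_path_def)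
  ultimately show ?thesis
    unfolding all_greater_iff_rat01[OF continuous_processD(2)[OF assms]] paths_above_def by simp
qed

lemma sets_all_greater:
  assumes "continuous_process M X"
  shows "{\<omega>\<in>space M. \<forall>t\<in>{0..1}. c < X t \<omega>} \<in> sets M"
proof -
  have "{\<omega>\<in>space M. \<forall>t\<in>{0..1}. c < X t \<omega>} = sample_path X -` paths_above c \<inter> space M"
    using sample_path_in_paths_above[OF assms] by auto
  also have "\<dots> \<in> sets M"
    using measurable_sample_path[OF assms] sets_paths_above by (rule measurable_sets)
  finally show ?thesis .
qed

section \<open>Spike functions and finite dimensional distributions\<close>

definition spike :: "real set \<Rightarrow> real \<Rightarrow> real \<Rightarrow> real" where
  "spike S c t = (if t \<in> S then c else 0)"

text \<open>A finite set is closed, so off \<open>S\<close> the spike is locally constant and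
  discontinuities can occur only in \<open>S\<close>.\<close>

lemma spike_in_E_minus:
  assumes "finite S" "c \<le> 0"
  shows "spike S c \<in> E_minus"
proof -
  have "continuous (at t within {0..1}) (spike S c)" if "t \<notin> S" for t
  proof -
    have "\<forall>\<^sub>F u in nhds t. u \<in> - S"
      using assms(1) that by (intro eventually_nhds_in_open) (auto simp: finite_imp_closed)
    then have "\<forall>\<^sub>F u in nhds t. spike S c u = 0"
      by eventually_elim (simp add: spike_def)
    then have "isCont (spike S c) t"
      by (subst isCont_cong) auto
    then show ?thesis by (rule continuous_at_imp_continuous_at_within)
  qed
  then have "{t\<in>{0..1}. \<not> continuous (at t within {0..1}) (spike S c)} \<subseteq> S" by blast
  then have "finite {t\<in>{0..1}. \<not> continuous (at t within {0..1}) (spike S c)}"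
    using assms(1) by (rule finite_subset)
  moreover have "spike S c ` {0..1} \<subseteq> {0, c}" by (auto simp: spike_def)
  then have "bounded (spike S c ` {0..1})" by (rule bounded_subset[rotated]) simp
  ultimately show ?thesis using assms(2) by (auto simp: E_minus_def spike_def)
qed

lemma sup_norm_spike_le: "sup_norm (spike S c) \<le> \<bar>c\<bar>"
  unfolding sup_norm_def by (rule cSUP_least) (auto simp: spike_def)

lemma sets_all_le:
  assumes "continuous_process M X"
  shows "{\<omega>\<in>space M. \<forall>t\<in>{0..1}. X t \<omega> \<le> a} \<in> sets M"
proof -
  have "{\<omega>\<in>space M. \<forall>t\<in>{0..1}. X t \<omega> \<le> a} = {\<omega>\<in>space M. \<forall>q\<in>rat01. X q \<omega> \<le> a}"
    using all_le_iff_rat01(1)[OF continuous_processD(2)[OF assms]] by auto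
  also have "\<dots> \<in> sets M"
    using rat01_subset continuous_processD(1)[OF assms]
    by (intro sets.sets_Collect_countable_All' countable_rat01 borel_measurable_le) auto
  finally show ?thesis .
qed

text \<open>Off \<open>S\<close> the spike only demands that the path be at most 0, which holds
  almost surely; what remains is a condition at finitely many times.\<close>

lemma process_df_spike:
  assumes "prob_space M" "continuous_process M X" "finite S" "S \<subseteq> {0..1}" "c \<le> 0"
    and nonpos: "AE \<omega> in M. \<forall>t\<in>{0..1}. X t \<omega> \<le> 0"
  shows "process_df M X (spike S c) = measure M {\<omega>\<in>space M. \<forall>s\<in>S. X s \<omega> \<le> c}"
proof -
  interpret prob_space M by fact
  have [measurable]: "X t \<in> borel_measurable M" if "t \<in> S" for t
    using continuous_processD(1)[OF assms(2)] that assms(4) by auto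
  have S: "{\<omega>\<in>space M. \<forall>s\<in>S. X s \<omega> \<le> c} \<in> events"
    by (intro sets.sets_Collect_countable_All' countable_finite assms(3)) measurable
  have eq: "{\<omega>\<in>space M. \<forall>t\<in>{0..1}. X t \<omega> \<le> spike S c t} =
      {\<omega>\<in>space M. \<forall>t\<in>{0..1}. X t \<omega> \<le> 0} \<inter> {\<omega>\<in>space M. \<forall>s\<in>S. X s \<omega> \<le> c}"
    using assms(4,5) by (auto simp: spike_def)
  show ?thesis
    unfolding process_df_def
  proof (rule finite_measure_eq_AE)
    show "AE \<omega> in M. \<omega> \<in> {\<omega>\<in>space M. \<forall>t\<in>{0..1}. X t \<omega> \<le> spike S c t} \<longleftrightarrow>
        \<omega> \<in> {\<omega>\<in>space M. \<forall>s\<in>S. X s \<omega> \<le> c}"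
      using nonpos unfolding eq by eventually_elim auto
    show "{\<omega>\<in>space M. \<forall>t\<in>{0..1}. X t \<omega> \<le> spike S c t} \<in> events"
      unfolding eq using S sets_all_le[OF assms(2)] by blast
  qed (rule S)
qed

text \<open>Each marginal gives probability \<open>exp 0 = 1\<close> to the half line up to 0.
  Countably many null sets cover the rational times, and continuity covers the rest.\<close>

lemma EVP_nonpos:
  assumes "standard_EVP K \<eta>"
  shows "AE \<omega> in K. \<forall>t\<in>{0..1}. \<eta> t \<omega> \<le> 0"
proof -
  have K: "prob_space K" and \<eta>: "continuous_process K \<eta>"
    and marg: "\<And>t. t \<in> {0..1} \<Longrightarrow> measure K {\<omega>\<in>space K. \<eta> t \<omega> \<le> 0} = 1"
    using assms unfolding standard_EVP_def by auto
  interpret prob_space K by fact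
  have "AE \<omega> in K. \<forall>q\<in>rat01. \<eta> q \<omega> \<le> 0"
  proof (rule AE_ball_countable[THEN iffD2, OF countable_rat01], rule)
    fix q assume "q \<in> rat01"
    then have q: "q \<in> {0..1}" using rat01_subset by auto
    have [measurable]: "\<eta> q \<in> borel_measurable K" by (rule continuous_processD(1)[OF \<eta> q])
    have "AE \<omega> in K. \<omega> \<in> {\<omega>\<in>space K. \<eta> q \<omega> \<le> 0}"
      using marg[OF q] by (intro AE_prob_1)
    then show "AE \<omega> in K. \<eta> q \<omega> \<le> 0" by auto
  qed
  with AE_space show ?thesis
    by eventually_elim (simp only: all_le_iff_rat01(1)[OF continuous_processD(2)[OF \<eta>]])
qed

text \<open>Applied to a spike, the defining relation of \<open>V\<close> takes the logarithm of a
  finite dimensional distribution of \<open>\<eta>\<close>, which cancels the exponential. Three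
  times suffice below: both end points and one \<open>t\<close>. They may coincide.\<close>

lemma GPP_prob_below_three:
  assumes EVP: "EVP_with_parameter \<psi> \<beta> K \<eta>" and GPP: "standard_GPP N V K \<eta>"
  obtains x0 where "x0 > 0"
    "\<And>c u v w. \<lbrakk>- x0 \<le> c; c \<le> 0; {u, v, w} \<subseteq> {0..1}\<rbrakk> \<Longrightarrow>
      measure N {\<omega>\<in>space N. V u \<omega> \<le> c \<and> V v \<omega> \<le> c \<and> V w \<omega> \<le> c} =
        1 - \<bar>c\<bar> * (LBINT s. max (scaled \<psi> \<beta> (s - u))
              (max (scaled \<psi> \<beta> (s - v)) (scaled \<psi> \<beta> (s - w))))"
proof -
  note EVP' = EVP[unfolded EVP_with_parameter_def]
  note sEVP = EVP'[THEN conjunct1]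
  note fdd = EVP'[THEN conjunct2, THEN spec, THEN mp, THEN spec, THEN spec, THEN mp]
  have K: "prob_space K" and \<eta>: "continuous_process K \<eta>"
    using sEVP unfolding standard_EVP_def by auto
  obtain x0 where N: "prob_space N" and V: "continuous_process N V" and "x0 > 0"
    and x0: "\<And>f. f \<in> E_minus \<Longrightarrow> sup_norm f \<le> x0 \<Longrightarrow>
      process_df N V f = 1 + ln (process_df K \<eta> f)"
    using GPP unfolding standard_GPP_def by auto
  interpret K: prob_space K by fact
  interpret N: prob_space N by fact
  note \<eta>_spike = process_df_spike[OF K \<eta> _ _ _ EVP_nonpos[OF sEVP]]
  have V_spike: "process_df N V (spike S c) = 1 + ln (measure K {\<omega>\<in>space K. \<forall>s\<in>S. \<eta> s \<omega> \<le> c})"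
    if "finite S" "S \<subseteq> {0..1}" "- x0 \<le> c" "c \<le> 0" for S c
    using that sup_norm_spike_le[of S c] by (simp add: x0 spike_in_E_minus \<eta>_spike)
  \<comment> \<open>The zero function is an admissible argument with \<open>ln 1 = 0\<close> on the
    right, so \<open>V\<close> is almost surely nonpositive too.\<close>
  have "process_df N V (spike {} 0) = 1"
    using V_spike[of "{}" 0] \<open>x0 > 0\<close> by (simp add: K.prob_space)
  then have "N.prob {\<omega>\<in>space N. \<forall>t\<in>{0..1}. V t \<omega> \<le> 0} = 1"
    by (simp add: process_df_def spike_def)
  then have "AE \<omega> in N. \<omega> \<in> {\<omega>\<in>space N. \<forall>t\<in>{0..1}. V t \<omega> \<le> 0}"
    by (rule N.AE_prob_1)
  then have nonpos: "AE \<omega> in N. \<forall>t\<in>{0..1}. V t \<omega> \<le> 0" by auto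
  show thesis
  proof (rule that[OF \<open>x0 > 0\<close>])
    fix c u v w assume c: "- x0 \<le> c" "c \<le> 0" and uvw: "{u, v, w} \<subseteq> {0..1::real}"
    define t :: "nat \<Rightarrow> real" where "t j = (if j = 1 then u else if j = 2 then v else w)" for j
    have 3: "{1..3} = {1, 2, 3::nat}" by auto
    have "N.prob {\<omega>\<in>space N. \<forall>s\<in>{u, v, w}. V s \<omega> \<le> c} =
        1 + ln (K.prob {\<omega>\<in>space K. \<forall>s\<in>{u, v, w}. \<eta> s \<omega> \<le> c})"
      using V_spike[of "{u, v, w}" c] process_df_spike[OF N V _ uvw c(2) nonpos] c uvw by simp
    also have "K.prob {\<omega>\<in>space K. \<forall>s\<in>{u, v, w}. \<eta> s \<omega> \<le> c} =
        K.prob {\<omega>\<in>space K. \<forall>j\<in>{1..3}. \<eta> (t j) \<omega> \<le> c}"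
      by (simp add: 3 t_def del: One_nat_def)
    also have "\<dots> = exp (- (LBINT s. (MAX j\<in>{1..3}. \<bar>c\<bar> * scaled \<psi> \<beta> (s - t j))))"
      using uvw c by (intro fdd) (auto simp: t_def)
    also have "(\<lambda>s. MAX j\<in>{1..3}. \<bar>c\<bar> * scaled \<psi> \<beta> (s - t j)) = (\<lambda>s. \<bar>c\<bar> *
        max (scaled \<psi> \<beta> (s - u)) (max (scaled \<psi> \<beta> (s - v)) (scaled \<psi> \<beta> (s - w))))"
      by (simp add: 3 t_def max_mult_distrib_left del: One_nat_def)
    finally show "N.prob {\<omega>\<in>space N. V u \<omega> \<le> c \<and> V v \<omega> \<le> c \<and> V w \<omega> \<le> c} =
        1 - \<bar>c\<bar> * (LBINT s. max (scaled \<psi> \<beta> (s - u))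
              (max (scaled \<psi> \<beta> (s - v)) (scaled \<psi> \<beta> (s - w))))"
      by simp
  qed
qed

section \<open>The probability that a whole path stays above a level\<close>

lemma (in prob_space) prob_Diff_Diff:
  assumes [measurable]: "A \<in> events" "B \<in> events" "C \<in> events"
  shows "prob (A - B - C) = prob A - prob (A \<inter> B) - prob (A \<inter> C) + prob (A \<inter> B \<inter> C)"
proof -
  have "prob (A - B - C) = prob (A - B) - prob ((A - B) \<inter> C)"
    by (rule finite_measure_Diff') auto
  also have "(A - B) \<inter> C = A \<inter> C - B" by auto
  also have "prob (A \<inter> C - B) = prob (A \<inter> C) - prob (A \<inter> C \<inter> B)"
    by (rule finite_measure_Diff') auto
  also have "prob (A - B) = prob A - prob (A \<inter> B)"
    by (rule finite_measure_Diff') auto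
  finally show ?thesis by (simp add: Int_ac)
qed

text \<open>By unimodality \<open>min (\<phi> s) (\<phi> (s - 1)) \<le> \<phi> (s - t)\<close> for \<open>t\<close> in \<open>[0,1]\<close>, so a path that
  is above \<open>c\<close> at both end points is almost surely above \<open>c\<close> at every fixed \<open>t\<close>.\<close>

lemma GPP_prob_above:
  assumes \<psi>: "unimodal_density \<psi>" and "\<beta> > 0"
    and EVP: "EVP_with_parameter \<psi> \<beta> K \<eta>" and GPP: "standard_GPP N V K \<eta>"
  obtains x0 where "x0 > 0"
    "\<And>c. \<lbrakk>- x0 \<le> c; c < 0\<rbrakk> \<Longrightarrow>
      measure N {\<omega>\<in>space N. \<forall>t\<in>{0..1}. c < V t \<omega>} = 2 * \<bar>c\<bar> * df \<psi> (- \<beta> / 2)"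
proof -
  define \<phi> where "\<phi> = scaled \<psi> \<beta>"
  have \<phi>: "unimodal_density \<phi>"
    unfolding \<phi>_def by (rule unimodal_density_scaled[OF \<psi> \<open>\<beta> > 0\<close>])
  obtain x0 where "x0 > 0" and below:
    "\<And>c u v w. \<lbrakk>- x0 \<le> c; c \<le> 0; {u, v, w} \<subseteq> {0..1}\<rbrakk> \<Longrightarrow>
      measure N {\<omega>\<in>space N. V u \<omega> \<le> c \<and> V v \<omega> \<le> c \<and> V w \<omega> \<le> c} =
        1 - \<bar>c\<bar> * (LBINT s. max (\<phi> (s - u)) (max (\<phi> (s - v)) (\<phi> (s - w))))"
    using GPP_prob_below_three[OF EVP GPP] unfolding \<phi>_def by blast
  have N: "prob_space N" and V: "continuous_process N V"
    using GPP unfolding standard_GPP_def by auto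
  interpret prob_space N by fact
  note [measurable] = continuous_processD(1)[OF V]
  define L where "L c t = {\<omega>\<in>space N. V t \<omega> \<le> c}" for c t
  have L [measurable]: "L c t \<in> events" if "t \<in> {0..1}" for c t
    using that unfolding L_def by measurable
  have int: "integrable lborel (\<lambda>s. \<phi> (s - t))" for t
    using lborel_integrable_real_affine[OF unimodal_densityD(2)[OF \<phi>], of 1 "- t"] by simp
  have one: "(LBINT s. \<phi> (s - t)) = 1" for t
    using lborel_integral_real_affine[of 1 \<phi> "- t"] unimodal_densityD(3)[OF \<phi>] by simp
  have P3: "prob (L c u \<inter> L c v \<inter> L c w) =
      1 - \<bar>c\<bar> * (LBINT s. max (\<phi> (s - u)) (max (\<phi> (s - v)) (\<phi> (s - w))))"
    if "- x0 \<le> c" "c \<le> 0" "{u, v, w} \<subseteq> {0..1}" for c u v w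
    unfolding below[OF that, symmetric] L_def by (auto intro!: arg_cong[where f=prob])
  \<comment> \<open>Repeating a time in the three-point formula gives the two-point and then the
    one-point formula.\<close>
  have P2: "prob (L c u \<inter> L c v) = 1 - \<bar>c\<bar> * (LBINT s. max (\<phi> (s - u)) (\<phi> (s - v)))"
    if "- x0 \<le> c" "c \<le> 0" "{u, v} \<subseteq> {0..1}" for c u v
    using P3[of c u v v] that by (simp add: Int_assoc)
  have P1: "prob (L c u) = 1 - \<bar>c\<bar>" if "- x0 \<le> c" "c \<le> 0" "u \<in> {0..1}" for c u
    using P2[of c u u] that by (simp add: one)
  \<comment> \<open>Inclusion-exclusion gives
    \<open>1 - 2 * (1 - \<bar>c\<bar>) + (1 - \<bar>c\<bar> * I)\<close> with \<open>I\<close> the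
    integral of the maximum. As maximum and minimum add up to a function of integral 2, this is
    \<open>\<bar>c\<bar>\<close> times the integral of the minimum.\<close>
  have ends: "prob (space N - L c 0 - L c 1) = 2 * \<bar>c\<bar> * df \<psi> (- \<beta> / 2)"
    if c: "- x0 \<le> c" "c \<le> 0" for c
  proof -
    have "(LBINT s. max (\<phi> s) (\<phi> (s - 1))) + (LBINT s. min (\<phi> s) (\<phi> (s - 1))) =
        (LBINT s. max (\<phi> s) (\<phi> (s - 1)) + min (\<phi> s) (\<phi> (s - 1)))"
      using int[of 0] int[of 1] by (intro Bochner_Integration.integral_add[symmetric]) auto
    also have "\<dots> = (LBINT s. \<phi> s + \<phi> (s - 1))"
      by (intro Bochner_Integration.integral_cong) auto
    also have "\<dots> = 2"
      using int[of 0] int[of 1] one[of 0] one[of 1]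
      by (subst Bochner_Integration.integral_add) auto
    finally have max: "(LBINT s. max (\<phi> s) (\<phi> (s - 1))) = 2 - 2 * df \<psi> (- (\<beta> / 2))"
      using integral_min_shift[OF \<phi>] df_scaled[OF \<open>\<beta> > 0\<close>, of \<psi> "- 1 / 2"]
      by (simp add: \<phi>_def)
    have "prob (L c 0 \<inter> L c 1) = 1 - \<bar>c\<bar> * (2 - 2 * df \<psi> (- (\<beta> / 2)))"
      using P2[of c 0 1] c by (simp add: max)
    moreover have "space N \<inter> L c t = L c t" for t by (auto simp: L_def)
    ultimately show ?thesis
      using c P1[of c 0] P1[of c 1]
      by (subst prob_Diff_Diff) (auto simp: prob_space algebra_simps)
  qed
  have null: "prob (L c t - L c 0 - L c 1) = 0" if c: "- x0 \<le> c" "c \<le> 0" and t: "t \<in> {0..1}" for c t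
  proof -
    have "(LBINT s. max (\<phi> (s - t)) (\<phi> (s - 0))) + (LBINT s. max (\<phi> (s - t)) (\<phi> (s - 1))) =
        (LBINT s. max (\<phi> (s - t)) (\<phi> (s - 0)) + max (\<phi> (s - t)) (\<phi> (s - 1)))"
      by (intro Bochner_Integration.integral_add[symmetric] integrable_max int)
    also have "\<dots> = (LBINT s. \<phi> (s - t) + max (\<phi> (s - t)) (max (\<phi> (s - 0)) (\<phi> (s - 1))))"
    proof (rule Bochner_Integration.integral_cong)
      fix s :: real
      \<comment> \<open>One end point is at least as far from \<open>s\<close> as \<open>t\<close>
        is, so its term is dominated by \<open>\<phi> (s - t)\<close>; this makes the two sums of
        maxima agree pointwise.\<close>
      have "\<bar>s - t\<bar> \<le> \<bar>s - 0\<bar> \<or> \<bar>s - t\<bar> \<le> \<bar>s - 1\<bar>" using t by auto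
      then have "\<phi> (s - 0) \<le> \<phi> (s - t) \<or> \<phi> (s - 1) \<le> \<phi> (s - t)"
        using unimodal_density_antimono_abs[OF \<phi>] by blast
      then show "max (\<phi> (s - t)) (\<phi> (s - 0)) + max (\<phi> (s - t)) (\<phi> (s - 1)) =
          \<phi> (s - t) + max (\<phi> (s - t)) (max (\<phi> (s - 0)) (\<phi> (s - 1)))"
        by auto
    qed simp
    also have "\<dots> = 1 + (LBINT s. max (\<phi> (s - t)) (max (\<phi> (s - 0)) (\<phi> (s - 1))))"
      by (subst Bochner_Integration.integral_add) (intro integrable_max int | simp add: one)+
    finally have "\<bar>c\<bar> * ((LBINT s. max (\<phi> (s - t)) (\<phi> (s - 0))) +
          (LBINT s. max (\<phi> (s - t)) (\<phi> (s - 1)))) =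
        \<bar>c\<bar> * (1 + (LBINT s. max (\<phi> (s - t)) (max (\<phi> (s - 0)) (\<phi> (s - 1)))))"
      by (rule arg_cong)
    moreover have "{t, 0, 1} \<subseteq> {0..1}" "{t, 0} \<subseteq> {0..1}" "{t, 1} \<subseteq> {0..1}"
      using t by auto
    ultimately have "prob (L c t) - prob (L c t \<inter> L c 0) - prob (L c t \<inter> L c 1) +
        prob (L c t \<inter> L c 0 \<inter> L c 1) = 0"
      unfolding distrib_left mult_1_right P1[OF c t]
      using P3[OF c, of t 0 1] P2[OF c, of t 0] P2[OF c, of t 1] by linarith
    then show ?thesis
      using t by (subst prob_Diff_Diff) auto
  qed
  define E where "E c = {\<omega>\<in>space N. \<forall>t\<in>{0..1}. c < V t \<omega>}" for c
  have E: "E c \<in> events" for c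
    unfolding E_def by (rule sets_all_greater[OF V])
  \<comment> \<open>Outside a null set, a path above \<open>c'\<close> at both ends is above
    \<open>c'\<close> at all rational times. Passing to all times only keeps
    \<open>\<ge> c'\<close>; the gap \<open>c < c'\<close> restores strictness.\<close>
  have lower: "2 * \<bar>c'\<bar> * df \<psi> (- \<beta> / 2) \<le> prob (E c)" if c: "- x0 \<le> c" "c < c'" "c' \<le> 0" for c c'
  proof -
    have c': "- x0 \<le> c'" "c' \<le> 0" using c by auto
    have "AE \<omega> in N. \<forall>q\<in>rat01. \<omega> \<notin> L c' q - L c' 0 - L c' 1"
    proof (rule AE_ball_countable[THEN iffD2, OF countable_rat01], rule)
      fix q assume "q \<in> rat01"
      then have "q \<in> {0..1}" using rat01_subset by auto
      with null[OF c' this] show "AE \<omega> in N. \<omega> \<notin> L c' q - L c' 0 - L c' 1"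
        by (intro AE_not_in) (auto simp: null_sets_def emeasure_eq_measure)
    qed
    with AE_space have "AE \<omega> in N. \<omega> \<in> space N - L c' 0 - L c' 1 \<longrightarrow> \<omega> \<in> E c"
    proof eventually_elim
      case (elim \<omega>)
      show ?case
      proof
        assume *: "\<omega> \<in> space N - L c' 0 - L c' 1"
        then have "\<forall>q\<in>rat01. c' \<le> V q \<omega>"
          using elim by (force simp: L_def)
        then have "\<forall>t\<in>{0..1}. c' \<le> V t \<omega>"
          by (simp only: all_le_iff_rat01(2)[OF continuous_processD(2)[OF V elim(1)]])
        with \<open>c < c'\<close> elim(1) show "\<omega> \<in> E c" by (force simp: E_def)
      qed
    qed
    then have "prob (space N - L c' 0 - L c' 1) \<le> prob (E c)"
      using E by (rule finite_measure_mono_AE)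
    with ends[OF c'] show ?thesis by simp
  qed
  show thesis
  proof (rule that[OF \<open>x0 > 0\<close>])
    fix c assume c: "- x0 \<le> c" "c < 0"
    have "prob (E c) \<le> prob (space N - L c 0 - L c 1)"
    proof (intro finite_measure_mono sets.Diff L)
      have "c < V 0 \<omega> \<and> c < V 1 \<omega> \<and> \<omega> \<in> space N" if "\<omega> \<in> E c" for \<omega>
        using that by (simp add: E_def)
      then show "E c \<subseteq> space N - L c 0 - L c 1"
        by (fastforce simp: L_def)
    qed auto
    also have "\<dots> = 2 * \<bar>c\<bar> * df \<psi> (- \<beta> / 2)"
      using c by (intro ends) auto
    finally have upper: "prob (E c) \<le> 2 * \<bar>c\<bar> * df \<psi> (- \<beta> / 2)" .
    \<comment> \<open>The levels \<open>c * (1 - 1/(n+1))\<close> lie in the range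
      \<open>c < c' \<le> 0\<close> required by \<open>lower\<close>, starting from 0, and decrease
      to \<open>c\<close>.\<close>
    have "(\<lambda>n. 2 * \<bar>c * (1 - inverse (Suc n))\<bar> * df \<psi> (- \<beta> / 2))
        \<longlonglongrightarrow> 2 * \<bar>c * (1 - 0)\<bar> * df \<psi> (- \<beta> / 2)"
      by (intro tendsto_intros LIMSEQ_inverse_real_of_nat)
    moreover have "2 * \<bar>c * (1 - inverse (Suc n))\<bar> * df \<psi> (- \<beta> / 2) \<le> prob (E c)" for n
      using c by (intro lower) (auto simp: field_simps mult_nonpos_nonneg)
    ultimately have "2 * \<bar>c * (1 - 0)\<bar> * df \<psi> (- \<beta> / 2) \<le> prob (E c)"
      by (rule LIMSEQ_le_const2[OF _ exI, OF _ allI, OF _ impI])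
    with upper show "prob {\<omega>\<in>space N. \<forall>t\<in>{0..1}. c < V t \<omega>} = 2 * \<bar>c\<bar> * df \<psi> (- \<beta> / 2)"
      by (simp add: E_def)
  qed
qed

section \<open>Asymptotic normality\<close>

lemma (in prob_space) bernoulli_central_limit:
  fixes Y :: "nat \<Rightarrow> 'a \<Rightarrow> real" and p :: real
  assumes indep: "indep_vars (\<lambda>_. borel) Y UNIV"
    and distr: "\<And>n. distr M borel (Y n) = D"
    and Y01: "\<And>n \<omega>. Y n \<omega> \<in> {0, 1}"
    and p: "\<And>n. prob {\<omega>\<in>space M. Y n \<omega> = 1} = p" "p < 1" "0 < p"
  shows "(\<lambda>n. prob {\<omega>\<in>space M. (\<Sum>i<n. Y i \<omega> - p) / sqrt (n * (p * (1 - p))) \<le> x})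
      \<longlonglongrightarrow> df std_normal_density x"
proof -
  have [measurable]: "Y n \<in> borel_measurable M" for n
    using indep unfolding indep_vars_def2 by auto
  have exp: "expectation (Y n) = p" for n
  proof -
    have "expectation (Y n) = expectation (indicator {\<omega>\<in>space M. Y n \<omega> = 1})"
      using Y01[of n] by (intro Bochner_Integration.integral_cong) (auto split: split_indicator)
    then show ?thesis by (simp add: p(1))
  qed
  \<comment> \<open>A variable with values 0 and 1 equals its square, so the second moment is
    \<open>p\<close> and the variance \<open>p - p\<^sup>2\<close>.\<close>
  have sq: "(\<lambda>\<omega>. (Y n \<omega>)\<^sup>2) = Y n" for n
    using Y01[of n] by (auto simp: fun_eq_iff) (metis power_one zero_power2)
  have int: "integrable M (Y n)" for n
    using Y01[of n] by (intro integrable_const_bound[where B=1]) (auto intro!: AE_I2, metis abs_0 abs_1 zero_le_one order_refl)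
  have var: "variance (Y n) = (sqrt (p * (1 - p)))\<^sup>2" for n
  proof -
    have "variance (Y n) = p - p\<^sup>2"
      by (subst variance_eq) (simp_all add: int sq exp)
    then show ?thesis
      using p(2,3) by (simp add: power2_eq_square algebra_simps)
  qed
  have "weak_conv_m (\<lambda>n. distr M borel (\<lambda>\<omega>. (\<Sum>i<n. Y i \<omega> - p) / sqrt (n * (sqrt (p * (1 - p)))\<^sup>2)))
      std_normal_distribution"
    by (rule central_limit_theorem[OF indep exp _ _ var distr]) (use p(2,3) in \<open>simp_all add: sq int\<close>)
  then show ?thesis
    using p(2,3) isCont_df[OF unimodal_density_std_normal]
    by (simp add: weak_conv_m_def weak_conv_def cdf_std_normal_distribution cdf_distr)
qed

theorem proposition3p1:
  fixes \<psi> :: "real \<Rightarrow> real" and \<beta> :: real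
    and K :: "'c measure" and \<eta> :: "real \<Rightarrow> 'c \<Rightarrow> real"
    and N :: "'b measure" and V :: "real \<Rightarrow> 'b \<Rightarrow> real"
    and M :: "'a measure" and X :: "nat \<Rightarrow> real \<Rightarrow> 'a \<Rightarrow> real"
  assumes "unimodal_density \<psi>"
    and "\<beta> > 0"
    and "EVP_with_parameter \<psi> \<beta> K \<eta>"
    and "standard_GPP N V K \<eta>"
    and "independent_copies M X N V"
  shows "\<exists>c0<0. \<forall>c. c0 < c \<and> c < 0 \<longrightarrow>
      converges_in_distribution M
        (\<lambda>n \<omega>. sqrt (real n) * (Psi_hat X c n \<omega> - df \<psi> (- \<beta> / 2)))
        (normal_dist 0
          (df \<psi> (- \<beta> / 2) * (1 - 2 * \<bar>c\<bar> * df \<psi> (- \<beta> / 2)) / (2 * \<bar>c\<bar>))) \<and>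
      (\<forall>b :: nat \<Rightarrow> 'a \<Rightarrow> real. (\<forall>n. b n \<in> borel_measurable M) \<longrightarrow>
        converges_in_distribution M
          (\<lambda>n \<omega>. sqrt (real n) * (beta_hat \<psi> X b c n \<omega> - \<beta>))
          (normal_dist 0
            (2 * df \<psi> (- \<beta> / 2) * (1 - 2 * \<bar>c\<bar> * df \<psi> (- \<beta> / 2)) /
              (\<bar>c\<bar> * (\<psi> (- \<beta> / 2))\<^sup>2))))"
proof -
  note \<psi> = assms(1)
  obtain x0 where "x0 > 0" and prob_V: "\<And>c. \<lbrakk>- x0 \<le> c; c < 0\<rbrakk> \<Longrightarrow>
      measure N {\<omega>\<in>space N. \<forall>t\<in>{0..1}. c < V t \<omega>} = 2 * \<bar>c\<bar> * df \<psi> (- \<beta> / 2)"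
    using GPP_prob_above[OF assms(1-4)] by blast
  have V: "continuous_process N V"
    using assms(4) unfolding standard_GPP_def by auto
  have M: "prob_space M" and X: "\<And>i. i \<ge> 1 \<Longrightarrow> continuous_process M (X i)"
    and X_distr: "\<And>i. i \<ge> 1 \<Longrightarrow>
      distr M path_space (sample_path (X i)) = distr N path_space (sample_path V)"
    and X_indep: "prob_space.indep_vars M (\<lambda>_. path_space) (\<lambda>i. sample_path (X i)) {1..}"
    using assms(5) unfolding independent_copies_def by auto
  interpret prob_space M by fact
  define a where "a = - \<beta> / 2"
  define P where "P = df \<psi> a"
  have P: "0 < P" "P < 1"
    unfolding P_def by (rule df_in_01[OF \<psi>])+
  \<comment> \<open>The bound \<open>- x0\<close> makes the exceedance formula available; the bound
    \<open>- 1 / 2\<close>, with \<open>P < 1\<close>, makes the success probability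
    \<open>2 * \<bar>c\<bar> * P\<close> less than 1.\<close>
  have conv_Psi: "converges_in_distribution M (\<lambda>n \<omega>. sqrt n * (Psi_hat X c n \<omega> - P))
        (normal_dist 0 (P * (1 - 2 * \<bar>c\<bar> * P) / (2 * \<bar>c\<bar>)))" (is "?conv_Psi")
    and conv_beta: "converges_in_distribution M (\<lambda>n \<omega>. sqrt n * (beta_hat \<psi> X b c n \<omega> - \<beta>))
        (normal_dist 0 (2 * P * (1 - 2 * \<bar>c\<bar> * P) / (\<bar>c\<bar> * (\<psi> a)\<^sup>2)))" (is "?conv_beta b")
    if "max (- x0) (- 1 / 2) < c" "c < 0" "\<And>n. b n \<in> borel_measurable M"
    for c and b :: "nat \<Rightarrow> 'a \<Rightarrow> real"
  proof -
    have c: "- x0 \<le> c" "- 1 / 2 < c" "c < 0" and [measurable]: "\<And>n. b n \<in> borel_measurable M"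
      using that by auto
    define C where "C = \<bar>c\<bar>"
    have C: "0 < C" "C < 1 / 2"
      using c by (auto simp: C_def)
    define p where "p = 2 * C * P"
    have "C * P < 1 / 2 * 1"
      using C P by (intro mult_strict_mono) auto
    then have p: "p < 1" "0 < p"
      using C(1) P(1) by (simp_all add: p_def)
    \<comment> \<open>The copies are numbered from 1 and the Bernoulli variables from 0, hence
      \<open>Suc i\<close>. The indicator is taken of the sample path so that law and independence
      carry over.\<close>
    define Y :: "nat \<Rightarrow> 'a \<Rightarrow> real" where
      "Y i \<omega> = indicator (paths_above c) (sample_path (X (Suc i)) \<omega>)" for i \<omega>
    have ind [measurable]: "indicator (paths_above c) \<in> measurable path_space (borel :: real measure)"
      by measurable
    have X_meas [measurable]: "sample_path (X (Suc i)) \<in> measurable M path_space" for i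
      by (rule measurable_sample_path[OF X]) simp
    have [measurable]: "sample_path V \<in> measurable N path_space"
      by (rule measurable_sample_path[OF V])
    have [measurable]: "Y i \<in> borel_measurable M" for i
      unfolding Y_def[abs_def] by measurable
    have Y_iff: "Y i \<omega> = of_bool (\<forall>t\<in>{0..1}. c < X (Suc i) t \<omega>)" if "\<omega> \<in> space M" for i \<omega>
      using sample_path_in_paths_above[OF X that] by (simp add: Y_def indicator_def)
    \<comment> \<open>Grouping the index set into the singletons \<open>{Suc j}\<close> reindexes
      the independent family by all natural numbers; the indicator then reads off the single
      coordinate.\<close>
    have "indep_vars (\<lambda>j. PiM {Suc j} (\<lambda>_. path_space))
        (\<lambda>j \<omega>. restrict (\<lambda>i. sample_path (X i) \<omega>) {Suc j}) UNIV"
      by (rule indep_vars_restrict[OF X_indep]) (auto simp: disjoint_family_on_def)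
    then have "indep_vars (\<lambda>_. borel) (\<lambda>j \<omega>. (\<lambda>w. indicator (paths_above c) (w (Suc j)) :: real)
        (restrict (\<lambda>i. sample_path (X i) \<omega>) {Suc j})) UNIV"
      by (rule indep_vars_compose2)
         (rule measurable_compose[OF _ ind], rule measurable_component_singleton, simp)
    then have Y_indep: "indep_vars (\<lambda>_. borel) Y UNIV"
      by (simp add: Y_def[abs_def])
    have Y_distr: "distr M borel (Y i) =
        distr (distr N path_space (sample_path V)) borel (indicator (paths_above c))" for i
      unfolding X_distr[of "Suc i", simplified, symmetric]
      by (subst distr_distr[OF ind X_meas]) (simp add: Y_def[abs_def] comp_def)
    have Y_prob: "prob {\<omega>\<in>space M. Y i \<omega> = 1} = p" for i
    proof -
      have "prob {\<omega>\<in>space M. Y i \<omega> = 1} = measure (distr M path_space (sample_path (X (Suc i)))) (paths_above c)"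
        by (subst measure_distr) (auto simp: Y_def indicator_def intro!: arg_cong[where f=prob])
      also have "\<dots> = measure N (sample_path V -` paths_above c \<inter> space N)"
        by (simp add: X_distr measure_distr)
      also have "sample_path V -` paths_above c \<inter> space N = {\<omega>\<in>space N. \<forall>t\<in>{0..1}. c < V t \<omega>}"
        using sample_path_in_paths_above[OF V] by auto
      finally show ?thesis
        using prob_V[OF c(1,3)] by (simp add: p_def C_def P_def a_def)
    qed
    \<comment> \<open>Since \<open>p = 2 * C * P\<close>, this is the Bernoulli standard deviation
      \<open>sqrt (p * (1 - p))\<close> divided by the normalisation \<open>2 * C\<close> of the
      estimator.\<close>
    define \<sigma> where "\<sigma> = sqrt (P * (1 - p) / (2 * C))"
    have var_pos: "P * (1 - p) / (2 * C) > 0" using P p C by simp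
    then have "\<sigma> > 0" and \<sigma>2: "\<sigma>\<^sup>2 = P * (1 - p) / (2 * C)"
      by (simp_all add: \<sigma>_def)
    have Psi_Y: "Psi_hat X c n \<omega> = (\<Sum>i<n. Y i \<omega>) / (2 * C * n)" if "\<omega> \<in> space M" for n \<omega>
      using that by (simp add: Psi_hat_def C_def Y_iff sum.atLeast1_atMost_eq)
    have [measurable]: "Psi_hat X c n \<in> borel_measurable M" for n
      by (subst measurable_cong[OF Psi_Y]) measurable
    have scale: "sqrt n * (Psi_hat X c n \<omega> - P) \<le> x \<longleftrightarrow>
        (\<Sum>i<n. Y i \<omega> - p) / sqrt (n * (p * (1 - p))) \<le> x / \<sigma>"
      if "\<omega> \<in> space M" "n > 0" for n \<omega> x
    proof -
      have "p * (1 - p) = (2 * C * \<sigma>)\<^sup>2"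
        unfolding power_mult_distrib \<sigma>2 using C by (simp add: p_def power2_eq_square)
      then have sd: "sqrt (n * (p * (1 - p))) = sqrt n * (2 * C * \<sigma>)"
        using C \<open>\<sigma> > 0\<close> by (simp only: real_sqrt_mult real_sqrt_abs) simp
      have cancel: "r * (A / (k * (r * r))) = A / (k * r)" if "r \<noteq> 0" for r A k :: real
        using that by simp
      have "sqrt n * (Psi_hat X c n \<omega> - P) = sqrt n * ((\<Sum>i<n. Y i \<omega> - p) / (2 * C * (sqrt n * sqrt n)))"
        using that C by (simp add: Psi_Y sum_subtractf p_def field_simps)
      also have "\<dots> = (\<Sum>i<n. Y i \<omega> - p) / (2 * C * sqrt n)"
        by (rule cancel) (use that in simp)
      also have "\<dots> = (\<Sum>i<n. Y i \<omega> - p) / sqrt (n * (p * (1 - p))) * \<sigma>"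
        using \<open>\<sigma> > 0\<close> by (simp add: sd)
      finally show ?thesis using \<open>\<sigma> > 0\<close> by (simp add: pos_le_divide_eq)
    qed
    have conv: "(\<lambda>n. prob {\<omega>\<in>space M. sqrt n * (Psi_hat X c n \<omega> - P) \<le> x})
        \<longlonglongrightarrow> df std_normal_density (x / \<sigma>)" for x
    proof (rule Lim_transform_eventually)
      have "Y n \<omega> \<in> {0, 1}" for n \<omega> by (simp add: Y_def indicator_def)
      then show "(\<lambda>n. prob {\<omega>\<in>space M. (\<Sum>i<n. Y i \<omega> - p) / sqrt (n * (p * (1 - p))) \<le> x / \<sigma>})
          \<longlonglongrightarrow> df std_normal_density (x / \<sigma>)"
        by (rule bernoulli_central_limit[OF Y_indep Y_distr _ Y_prob p])
      show "\<forall>\<^sub>F n in sequentially.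
          prob {\<omega>\<in>space M. (\<Sum>i<n. Y i \<omega> - p) / sqrt (n * (p * (1 - p))) \<le> x / \<sigma>} =
          prob {\<omega>\<in>space M. sqrt n * (Psi_hat X c n \<omega> - P) \<le> x}"
        using eventually_gt_at_top[of 0]
        by eventually_elim (auto simp: scale intro!: arg_cong[where f=prob])
    qed
    then show ?conv_Psi
      using var_pos by (subst converges_in_distribution_iff) (auto simp: \<sigma>_def p_def C_def)
    define B where "B = beta_hat \<psi> X b c"
    have [measurable]: "B n \<in> borel_measurable M" for n
    proof -
      \<comment> \<open>measurable because \<^term>\<open>Psi_hat X c n\<close> takes finitely many values\<close>
      have "simple_function M (Y i)" for i
        by (rule simple_function_borel_measurable)
           (auto simp: Y_def indicator_def intro!: finite_subset[of _ "{0, 1}"])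
      then have "simple_function M (\<lambda>\<omega>. (\<Sum>i<n. Y i \<omega>) / (2 * C * n))"
        by (intro simple_function_div simple_function_sum simple_function_const) auto
      then have "simple_function M (Psi_hat X c n)"
        by (simp add: Psi_Y cong: simple_function_cong)
      then have "simple_function M (\<lambda>\<omega>. quantile \<psi> (Psi_hat X c n \<omega>))"
        by (rule simple_function_compose1)
      then have [measurable]: "(\<lambda>\<omega>. quantile \<psi> (Psi_hat X c n \<omega>)) \<in> borel_measurable M"
        by (rule borel_measurable_simple_function)
      show ?thesis
        unfolding B_def beta_hat_def[abs_def] by measurable
    qed
    have "\<psi> a > 0" by (rule unimodal_densityD(4)[OF \<psi>])
    \<comment> \<open>The slope of \<open>-2\<close> times the quantile at \<open>P\<close> has
      absolute value \<open>2 / \<psi> a\<close>; this factor multiplies \<open>\<sigma>\<close> and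
      yields the second variance.\<close>
    have "(2 * \<sigma> / \<psi> a)\<^sup>2 = 2 * P * (1 - p) / (C * (\<psi> a)\<^sup>2)"
      by (simp add: power_divide power_mult_distrib \<sigma>2)
    moreover have "2 * \<sigma> / \<psi> a > 0" using \<open>\<sigma> > 0\<close> \<open>\<psi> a > 0\<close> by simp
    ultimately have sd: "sqrt (2 * P * (1 - p) / (C * (\<psi> a)\<^sup>2)) = 2 * \<sigma> / \<psi> a"
      by (metis less_imp_le real_sqrt_pow2_iff real_sqrt_unique)
    have "converges_in_distribution M (\<lambda>n \<omega>. sqrt n * (B n \<omega> - (- 2 * a)))
        (normal_dist 0 (2 * P * (1 - p) / (C * (\<psi> a)\<^sup>2)))"
    proof (subst converges_in_distribution_iff)
      show "0 < 2 * P * (1 - p) / (C * (\<psi> a)\<^sup>2)"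
        using \<open>\<psi> a > 0\<close> P p C by simp
      show "\<forall>x. (\<lambda>n. prob {\<omega>\<in>space M. sqrt n * (B n \<omega> - (- 2 * a)) \<le> x})
          \<longlonglongrightarrow> df std_normal_density (x / sqrt (2 * P * (1 - p) / (C * (\<psi> a)\<^sup>2)))"
        unfolding sd
        by (intro allI prob_quantile_estimator_tendsto[OF \<psi> \<open>\<sigma> > 0\<close> _ _ conv[unfolded P_def]])
           (measurable, simp add: B_def beta_hat_def)
    qed measurable
    then show "?conv_beta b"
      by (simp add: B_def a_def p_def C_def)
  qed
  show ?thesis
  \<comment> \<open>The first limit was proved under the measurability premise on \<open>b\<close>
    that the second one uses; the zero sequence discharges it.\<close>
  proof (intro exI[of _ "max (- x0) (- 1 / 2)"] conjI allI impI)
    show "max (- x0) (- 1 / 2) < 0" using \<open>x0 > 0\<close> by simp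
  qed (use conv_Psi[of _ "\<lambda>_ _. 0"] conv_beta in \<open>simp_all add: P_def a_def\<close>)
qed

end
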